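(* If $n$ is a non-negative integer and $t$ is any integer, then $$\sum_{k=1}^n(-4)^{k}\frac{k}{n+k}\binom{n+k}{n-k}L_{k+t}=\begin{cases}-\frac12L_{t+1}L_{3n},& n\text{ odd};\\ \frac52F_{t+1}F_{3n},& n\text{ even};\end{cases}$$ $$\sum_{k=1}^n(-4)^{k}\frac{k}{n+k}\binom{n+k}{n-k}F_{k+t}=\begin{cases}-\frac12F_{t+1}L_{3n},& n\text{ odd};\\ \frac12L_{t+1}F_{3n},& n\text{ even}.\end{cases}$$
   Context: $F_n$ and $L_n$ ($n\in\mathbb{Z}$) are the Fibonacci and Lucas numbers: $F_0=0$, $F_1=1$, $F_n=F_{n-1}+F_{n-2}$; $L_0=2$, $L_1=1$, $L_n=L_{n-1}+L_{n-2}$, extended to negative indices by $F_{-n}=(-1)^{n-1}F_n$, $L_{-n}=(-1)^nL_n$. An empty sum is $0$. *)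

theory Defs
  imports Complex_Main "HOL-Number_Theory.Fib"
begin

fun lucas :: "nat \<Rightarrow> nat" where
  "lucas 0 = 2"
| "lucas (Suc 0) = 1"
| "lucas (Suc (Suc n)) = lucas (Suc n) + lucas n"

definition fib_int :: "int \<Rightarrow> int" where
  "fib_int m =
     (if m \<ge> 0 then int (fib (nat m))
      else (- 1) ^ (nat (- m) - 1) * int (fib (nat (- m))))"

definition lucas_int :: "int \<Rightarrow> int" where
  "lucas_int m =
     (if m \<ge> 0 then int (lucas (nat m))
      else (- 1) ^ nat (- m) * int (lucas (nat (- m))))"

end

theory Submission imports Defs begin

text \<open>
  By absorption the summand's coefficient is half of \<open>(n + k - 1) choose (2 * k - 1)\<close>, and two
  applications of Pascal's rule show that \<open>P n x = (\<Sum>k. ((n + k - 1) choose (2 * k - 1)) * x ^ k)\<close>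
  satisfies \<open>P (n + 2) x = (x + 2) * P (n + 1) x - P n x\<close>. Read umbrally, with \<open>x ^ k\<close>
  standing for \<open>(-4) ^ k * G (k + t)\<close>, this is a recurrence in \<open>n\<close> that holds for an arbitrary
  function \<open>G\<close>. If \<open>G\<close> obeys the Fibonacci recurrence, induction on \<open>n\<close> gives the closed form,
  from \<open>F (m + 6) + F m = 2 * L (m + 3)\<close> and \<open>L (m + 6) + L m = 10 * F (m + 3)\<close>.
  Both claims are the instances \<open>G = L\<close> and \<open>G = F\<close>.
\<close>

text \<open>The window \<open>t\<close>, \<open>t + 1\<close>, \<open>t + 2\<close> lies on the
  nonnegative side, straddles the sign change, or has \<open>t + 2 \<le> 0\<close>.\<close>

lemma int_cases_near_zero:
  obtains (nonneg) m where "t = int m" | (minus_one) "t = - 1"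
    | (le_minus_two) m where "t = - int (m + 2)"
  using that(1)[of "nat t"] that(2) that(3)[of "nat (- t - 2)"] by linarith

lemma fib_int_rec: "fib_int (t + 2) = fib_int (t + 1) + fib_int t"
proof (cases t rule: int_cases_near_zero)
  case (nonneg m)
  then have "nat (t + 2) = Suc (Suc m)" "nat (t + 1) = Suc m"
    by auto
  with nonneg show ?thesis
    by (simp add: fib_int_def)
next
  case minus_one
  then show ?thesis
    by (simp add: fib_int_def)
next
  case (le_minus_two m)
  then have "nat (- t) = Suc (Suc m)" "nat (- (t + 1)) = Suc m" "nat (- (t + 2)) = m"
    by auto
  with le_minus_two show ?thesis
    \<comment> \<open>For \<open>m = 0\<close> the term at \<open>t + 2 = 0\<close> falls under the
      nonnegative branch of the definition.\<close>
    by (cases m) (auto simp: fib_int_def algebra_simps)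
qed

lemma lucas_Suc_eq_fib: "lucas (Suc m) = fib m + fib (Suc (Suc m))"
  by (induction m rule: induct_nat_012) auto

lemma lucas_int_eq_fib_int: "lucas_int (t + 1) = fib_int t + fib_int (t + 2)"
proof (cases t rule: int_cases_near_zero)
  case (nonneg m)
  then have "nat (t + 2) = Suc (Suc m)" "nat (t + 1) = Suc m"
    by auto
  with nonneg show ?thesis
    by (simp add: fib_int_def lucas_int_def lucas_Suc_eq_fib)
next
  case minus_one
  then show ?thesis
    by (simp add: fib_int_def lucas_int_def)
next
  case (le_minus_two m)
  then have "nat (- t) = Suc (Suc m)" "nat (- (t + 1)) = Suc m" "nat (- (t + 2)) = m"
    by auto
  with le_minus_two show ?thesis
    by (cases m) (auto simp: fib_int_def lucas_int_def lucas_Suc_eq_fib algebra_simps)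
qed

text \<open>Case b = 3 of F(a+b) + F(a-b) = F(b) L(a) for odd b.\<close>

lemma fib_add_6: "fib (m + 6) + fib m = 2 * lucas (m + 3)"
  by (simp add: lucas_Suc_eq_fib numeral_eq_Suc)

lemma lucas_add_6: "lucas (m + 6) + lucas m = 10 * fib (m + 3)"
  by (cases m) (simp_all add: lucas_Suc_eq_fib numeral_eq_Suc)

lemma lucas_int_rec: "lucas_int (t + 2) = lucas_int (t + 1) + lucas_int t"
  using lucas_int_eq_fib_int[of "t - 1"] lucas_int_eq_fib_int[of t] lucas_int_eq_fib_int[of "t + 1"]
    fib_int_rec[of "t - 1"] fib_int_rec[of "t + 1"]
  by (simp add: algebra_simps)

text \<open>The right side is F(t-1) + 2 F(t+1) + F(t+3), and F(t-1) + F(t+3) = 3 F(t+1).\<close>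

lemma five_fib_int_eq_lucas_int: "5 * fib_int (t + 1) = lucas_int t + lucas_int (t + 2)"
  using lucas_int_eq_fib_int[of "t - 1"] lucas_int_eq_fib_int[of "t + 1"]
    fib_int_rec[of "t - 1"] fib_int_rec[of t] fib_int_rec[of "t + 1"]
  by (simp add: algebra_simps)

text \<open>Indexing by j = k - 1 avoids truncated subtraction. For \<open>a j = x ^ j\<close> and
  \<open>n \<ge> 1\<close> this is the Morgan-Voyce polynomial B of index n - 1.\<close>

definition odd_binomial_sum :: "(nat \<Rightarrow> real) \<Rightarrow> nat \<Rightarrow> real" where
  "odd_binomial_sum a n = (\<Sum>j<n. real ((n + j) choose (2 * j + 1)) * a j)"

text \<open>The added terms vanish, as n + j < 2j + 1 for \<open>j \<ge> n\<close>; sums for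
  different \<open>n\<close> thus get a common range.\<close>

lemma odd_binomial_sum_extend:
  assumes "n \<le> N"
  shows "odd_binomial_sum a n = (\<Sum>j<N. real ((n + j) choose (2 * j + 1)) * a j)"
  unfolding odd_binomial_sum_def
  by (rule sum.mono_neutral_left) (use assms in \<open>auto simp: not_less\<close>)

lemma odd_binomial_sum_Suc_Suc:
  "odd_binomial_sum a (Suc (Suc n)) =
     2 * odd_binomial_sum a (Suc n) - odd_binomial_sum a n
     + odd_binomial_sum (\<lambda>j. a (Suc j)) (Suc n)"
proof -
  \<comment> \<open>The Pascal remainder. At \<open>j = 0\<close> truncated subtraction would give
    \<open>n choose 0 = 1\<close> instead of the required 0.\<close>
  define B where "B j = (if j = 0 then 0 else real ((n + j) choose (2 * j - 1)))" for j
  have B_0: "B 0 = 0" and B_Suc: "B (Suc j) = real ((Suc n + j) choose (2 * j + 1))" for j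
    by (simp_all add: B_def)
  have pascal: "real ((Suc (Suc n) + j) choose (2 * j + 1)) =
      2 * real ((Suc n + j) choose (2 * j + 1)) - real ((n + j) choose (2 * j + 1)) + B j" for j
    by (cases j) (simp_all add: B_0 B_Suc)
  have "(\<Sum>j<Suc (Suc n). B j * a j) = odd_binomial_sum (\<lambda>j. a (Suc j)) (Suc n)"
    unfolding odd_binomial_sum_def by (subst sum.lessThan_Suc_shift) (simp add: B_0 B_Suc)
  moreover have "odd_binomial_sum a (Suc (Suc n)) =
      2 * (\<Sum>j<Suc (Suc n). real ((Suc n + j) choose (2 * j + 1)) * a j)
      - (\<Sum>j<Suc (Suc n). real ((n + j) choose (2 * j + 1)) * a j) + (\<Sum>j<Suc (Suc n). B j * a j)"
    unfolding odd_binomial_sum_def pascal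
    by (simp add: sum_distrib_left sum.distrib sum_subtractf algebra_simps del: sum.lessThan_Suc)
  ultimately show ?thesis
    by (simp add: odd_binomial_sum_extend[of "Suc n" "Suc (Suc n)"]
        odd_binomial_sum_extend[of n "Suc (Suc n)"] del: sum.lessThan_Suc)
qed

lemma half_binomial_absorb:
  assumes "1 \<le> k" "k \<le> n"
  shows "real k / real (n + k) * real ((n + k) choose (n - k)) =
    real ((n + k - 1) choose (2 * k - 1)) / 2"
proof -
  have "(n + k) choose (n - k) = (n + k) choose (2 * k)"
    using assms by (subst binomial_symmetric) auto
  moreover have "2 * k * ((n + k) choose (2 * k)) = (n + k) * ((n + k - 1) choose (2 * k - 1))"
    using times_binomial_minus1_eq[of "2 * k" "n + k"] assms by simp
  then have "2 * real k * real ((n + k) choose (2 * k)) =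
      real (n + k) * real ((n + k - 1) choose (2 * k - 1))"
    by (metis of_nat_mult of_nat_numeral)
  ultimately show ?thesis
    using assms by (simp add: field_simps del: of_nat_add)
qed

lemma sum_eq_odd_binomial_sum:
  fixes G :: "int \<Rightarrow> real"
  shows "(\<Sum>k=1..n. (- 4) ^ k * (real k / real (n + k)) * real ((n + k) choose (n - k))
      * G (int k + t)) = odd_binomial_sum (\<lambda>j. (- 4) ^ Suc j * G (int j + 1 + t)) n / 2"
proof -
  have "(\<Sum>k=1..n. (- 4) ^ k * (real k / real (n + k)) * real ((n + k) choose (n - k))
      * G (int k + t)) =
      (\<Sum>k=1..n. real ((n + k - 1) choose (2 * k - 1)) / 2 * ((- 4) ^ k * G (int k + t)))"
    by (rule sum.cong[OF refl], subst half_binomial_absorb[symmetric]) (simp_all add: mult_ac)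
  also have "\<dots> = (\<Sum>j<n. real ((n + Suc j - 1) choose (2 * Suc j - 1)) / 2
      * ((- 4) ^ Suc j * G (int (Suc j) + t)))"
    by (rule sum.reindex_bij_witness[of _ Suc "\<lambda>k. k - 1"]) auto
  finally show ?thesis
    by (simp add: odd_binomial_sum_def sum_divide_distrib add.commute)
qed

lemma odd_binomial_sum_fibonacci:
  fixes G :: "int \<Rightarrow> real"
  assumes G: "\<And>t. G (t + 2) = G (t + 1) + G t"
  shows "odd_binomial_sum (\<lambda>j. (- 4) ^ Suc j * G (int j + 1 + t)) n =
    (if odd n then - real (lucas (3 * n)) * G (t + 1)
     else real (fib (3 * n)) * (G t + G (t + 2)))"
\<comment> \<open>The shift of \<open>a\<close> replaces \<open>t\<close> by \<open>t + 1\<close>,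
  so \<open>t\<close> must vary.\<close>
proof (induction n arbitrary: t rule: induct_nat_012)
  case 0
  show ?case by (simp add: odd_binomial_sum_def)
next
  case 1
  show ?case by (simp add: odd_binomial_sum_def numeral_eq_Suc add.commute)
next
  case (ge2 n)
  let ?S = "\<lambda>n t. odd_binomial_sum (\<lambda>j. (- 4) ^ Suc j * G (int j + 1 + t)) n"
  have "odd_binomial_sum (\<lambda>j. (- 4) ^ Suc (Suc j) * G (int (Suc j) + 1 + t)) (Suc n)
      = - 4 * ?S (Suc n) (t + 1)"
    by (simp add: odd_binomial_sum_def sum_distrib_left algebra_simps del: sum.lessThan_Suc)
  then have rec: "?S (Suc (Suc n)) t = 2 * ?S (Suc n) t - ?S n t - 4 * ?S (Suc n) (t + 1)"
    using odd_binomial_sum_Suc_Suc[of "\<lambda>j. (- 4) ^ Suc j * G (int j + 1 + t)" n] by simp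
  have F: "real (fib (3 * Suc (Suc n))) = 2 * real (lucas (3 * Suc n)) - real (fib (3 * n))"
    using fib_add_6[of "3 * n"] by (simp add: algebra_simps)
  have L: "real (lucas (3 * Suc (Suc n))) = 10 * real (fib (3 * Suc n)) - real (lucas (3 * n))"
    using lucas_add_6[of "3 * n"] by (simp add: algebra_simps)
  have G2: "G (t + 2) = G (t + 1) + G t" "G (t + 1 + 2) = 2 * G (t + 1) + G t"
    using G[of t] G[of "t + 1"] by (simp_all add: algebra_simps)
  have G2': "G (t + 1 + 1) = G (t + 1) + G t"
    using G[of t] by (simp add: algebra_simps)
  \<comment> \<open>With C(t) = G(t) + G(t+2), the parities close up by 4 G(t+2) - 2 G(t+1) = 2 C(t)
    for even \<open>n\<close> and 2 C(t) - 4 C(t+1) = -10 G(t+1) for odd \<open>n\<close>.\<close>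
  show ?case
    unfolding rec ge2.IH F L G2 G2'
    by (simp add: algebra_simps)
qed

theorem theorem18:
  fixes n :: nat and t :: int
  shows
    "(\<Sum>k=1..n. (- 4) ^ k * (real k / real (n + k)) * real ((n + k) choose (n - k))
         * real_of_int (lucas_int (int k + t)))
      = (if odd n
         then - (1 / 2) * real_of_int (lucas_int (t + 1)) * real_of_int (lucas_int (3 * int n))
         else 5 / 2 * real_of_int (fib_int (t + 1)) * real_of_int (fib_int (3 * int n)))
     \<and>
     (\<Sum>k=1..n. (- 4) ^ k * (real k / real (n + k)) * real ((n + k) choose (n - k))
         * real_of_int (fib_int (int k + t)))
      = (if odd n
         then - (1 / 2) * real_of_int (fib_int (t + 1)) * real_of_int (lucas_int (3 * int n))
         else 1 / 2 * real_of_int (lucas_int (t + 1)) * real_of_int (fib_int (3 * int n)))"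
proof -
  have L_closed: "odd_binomial_sum (\<lambda>j. (- 4) ^ Suc j * real_of_int (lucas_int (int j + 1 + t))) n =
      (if odd n then - real (lucas (3 * n)) * real_of_int (lucas_int (t + 1))
       else real (fib (3 * n)) * (real_of_int (lucas_int t) + real_of_int (lucas_int (t + 2))))"
    by (rule odd_binomial_sum_fibonacci) (simp add: lucas_int_rec)
  have F_closed: "odd_binomial_sum (\<lambda>j. (- 4) ^ Suc j * real_of_int (fib_int (int j + 1 + t))) n =
      (if odd n then - real (lucas (3 * n)) * real_of_int (fib_int (t + 1))
       else real (fib (3 * n)) * (real_of_int (fib_int t) + real_of_int (fib_int (t + 2))))"
    by (rule odd_binomial_sum_fibonacci) (simp add: fib_int_rec)
  have fib_3n: "fib_int (3 * int n) = int (fib (3 * n))"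
    and lucas_3n: "lucas_int (3 * int n) = int (lucas (3 * n))"
    by (simp_all add: fib_int_def lucas_int_def nat_mult_distrib)
  \<comment> \<open>For even \<open>n\<close>, the factor 5 here and the half from absorption give
    5/2.\<close>
  have lucas_sum: "real_of_int (lucas_int t) + real_of_int (lucas_int (t + 2)) =
      5 * real_of_int (fib_int (t + 1))"
    by (metis five_fib_int_eq_lucas_int of_int_add of_int_mult of_int_numeral)
  have fib_sum: "real_of_int (fib_int t) + real_of_int (fib_int (t + 2)) =
      real_of_int (lucas_int (t + 1))"
    by (simp add: lucas_int_eq_fib_int)
  show ?thesis
    unfolding sum_eq_odd_binomial_sum[of n "\<lambda>m. real_of_int (lucas_int m)" t]
      sum_eq_odd_binomial_sum[of n "\<lambda>m. real_of_int (fib_int m)" t]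
      L_closed F_closed fib_3n lucas_3n lucas_sum fib_sum
    by simp
qed

end
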